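(* OBFOL is strictly less expressive than CBFOL and than DBFOL: every OBFOL sentence is a CBFOL sentence and a DBFOL sentence, and there exist a language signature $\Sigma$ and a CBFOL sentence over $\Sigma(\mathrm{Var})$ that is not equivalent to any OBFOL sentence over $\Sigma(\mathrm{Var})$, and likewise a DBFOL sentence over $\Sigma(\mathrm{Var})$ not equivalent to any OBFOL sentence over $\Sigma(\mathrm{Var})$.
   Context: Language signature $\Sigma=(\mathrm{Args},\mathrm{Rels},\mathrm{ar})$: $\mathrm{Args},\mathrm{Rels}$ finite non-empty, $\mathrm{ar}:\mathrm{Rels}\to\mathcal P(\mathrm{Args})\setminus\{\emptyset\}$. A $\Sigma$-structure $\mathcal R=(D,\cdot^{\mathcal R})$: $D$ non-empty, $r^{\mathcal R}$ a set of functions $\mathrm{ar}(r)\to D$. FOL formulas over $\Sigma(\mathrm{Var})$: $\varphi::= r\mid\neg\varphi\mid\varphi\wedge\varphi\mid\varphi\vee\varphi\mid\exists x.\varphi\mid\forall x.\varphi\mid(a,x)\varphi$. Free placeholders: $\mathrm{free}(r)=\mathrm{ar}(r)$; unchanged by $\neg$; union for $\wedge,\vee$; $\mathrm{free}(Qx.\varphi)=\mathrm{free}(\varphi)\setminus\{x\}$; $\mathrm{free}((a,x)\varphi)=(\mathrm{free}(\varphi)\setminus\{a\})\cup\{x\}$ if $a\in\mathrm{free}(\varphi)$, else $\mathrm{free}(\varphi)$; sentences have none. Semantics: $\mathcal R,\chi\models r$ iff $\chi|_{\mathrm{ar}(r)}\in r^{\mathcal R}$; usual Boolean and quantifier clauses;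 $\mathcal R,\chi\models(a,x)\varphi$ iff $\mathcal R,\chi[a\mapsto\chi(x)]\models\varphi$; $\mathcal R\models\varphi$ iff $\mathcal R,\emptyset\models\varphi$. Two sentences are equivalent iff they have the same models. Quantification prefix: finite word over $\{\exists x,\forall x\}$, each variable at most once; binding prefix: finite word over pairs $(a,x)$, each argument at most once; derived relation: Boolean combination of relations all with the same argument set. Fragments: $\varphi::=\wp\psi\mid(\varphi\wedge\varphi)\mid(\varphi\vee\varphi)$ where, for CBFOL, $\psi::=\flat\bar r\mid(\psi\wedge\psi)$; for DBFOL, $\psi::=\flat\bar r\mid(\psi\vee\psi)$; for OBFOL, $\psi::=\flat\bar r$ ($\wp$ quantification prefix, $\flat$ binding prefix, $\bar r$ derived relation). *)

theory Defs
  imports Main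
begin

record ('a, 'r) signature =
  Args :: "'a set"
  Rels :: "'r set"
  ar :: "'r \<Rightarrow> 'a set"

definition wf_signature :: "('a, 'r) signature \<Rightarrow> bool" where
  "wf_signature \<Sigma> \<longleftrightarrow>
     finite (Args \<Sigma>) \<and> Args \<Sigma> \<noteq> {} \<and> finite (Rels \<Sigma>) \<and> Rels \<Sigma> \<noteq> {} \<and>
     (\<forall>r \<in> Rels \<Sigma>. ar \<Sigma> r \<subseteq> Args \<Sigma> \<and> ar \<Sigma> r \<noteq> {})"

text \<open>A function from \<open>ar \<Sigma> r\<close> to the domain is represented as a partial map whose
  \<^const>\<open>dom\<close> is exactly \<open>ar \<Sigma> r\<close>.\<close>

record ('a, 'r, 'd) struct =
  Dom :: "'d set"
  interp :: "'r \<Rightarrow> ('a \<rightharpoonup> 'd) set"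

definition is_structure :: "('a, 'r) signature \<Rightarrow> ('a, 'r, 'd) struct \<Rightarrow> bool" where
  "is_structure \<Sigma> R \<longleftrightarrow>
     Dom R \<noteq> {} \<and>
     (\<forall>r \<in> Rels \<Sigma>. \<forall>t \<in> interp R r. dom t = ar \<Sigma> r \<and> ran t \<subseteq> Dom R)"

text \<open>The set of variables is the whole type \<open>'v\<close>. Placeholders, i.e. arguments and
  variables, are kept disjoint by the sum type \<open>'a + 'v\<close>.\<close>

datatype ('a, 'r, 'v) fm =
    Rel 'r
  | Neg "('a, 'r, 'v) fm"
  | Conj "('a, 'r, 'v) fm" "('a, 'r, 'v) fm"
  | Disj "('a, 'r, 'v) fm" "('a, 'r, 'v) fm"
  | Ex 'v "('a, 'r, 'v) fm"
  | All 'v "('a, 'r, 'v) fm"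
  | Bind 'a 'v "('a, 'r, 'v) fm"

primrec fol :: "('a, 'r) signature \<Rightarrow> ('a, 'r, 'v) fm \<Rightarrow> bool" where
  "fol \<Sigma> (Rel r) \<longleftrightarrow> r \<in> Rels \<Sigma>"
| "fol \<Sigma> (Neg \<phi>) \<longleftrightarrow> fol \<Sigma> \<phi>"
| "fol \<Sigma> (Conj \<phi> \<psi>) \<longleftrightarrow> fol \<Sigma> \<phi> \<and> fol \<Sigma> \<psi>"
| "fol \<Sigma> (Disj \<phi> \<psi>) \<longleftrightarrow> fol \<Sigma> \<phi> \<and> fol \<Sigma> \<psi>"
| "fol \<Sigma> (Ex x \<phi>) \<longleftrightarrow> fol \<Sigma> \<phi>"
| "fol \<Sigma> (All x \<phi>) \<longleftrightarrow> fol \<Sigma> \<phi>"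
| "fol \<Sigma> (Bind a x \<phi>) \<longleftrightarrow> a \<in> Args \<Sigma> \<and> fol \<Sigma> \<phi>"

primrec free :: "('a, 'r) signature \<Rightarrow> ('a, 'r, 'v) fm \<Rightarrow> ('a + 'v) set" where
  "free \<Sigma> (Rel r) = Inl ` ar \<Sigma> r"
| "free \<Sigma> (Neg \<phi>) = free \<Sigma> \<phi>"
| "free \<Sigma> (Conj \<phi> \<psi>) = free \<Sigma> \<phi> \<union> free \<Sigma> \<psi>"
| "free \<Sigma> (Disj \<phi> \<psi>) = free \<Sigma> \<phi> \<union> free \<Sigma> \<psi>"
| "free \<Sigma> (Ex x \<phi>) = free \<Sigma> \<phi> - {Inr x}"
| "free \<Sigma> (All x \<phi>) = free \<Sigma> \<phi> - {Inr x}"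
| "free \<Sigma> (Bind a x \<phi>) =
     (if Inl a \<in> free \<Sigma> \<phi> then (free \<Sigma> \<phi> - {Inl a}) \<union> {Inr x} else free \<Sigma> \<phi>)"

definition sentence :: "('a, 'r) signature \<Rightarrow> ('a, 'r, 'v) fm \<Rightarrow> bool" where
  "sentence \<Sigma> \<phi> \<longleftrightarrow> fol \<Sigma> \<phi> \<and> free \<Sigma> \<phi> = {}"

text \<open>Assignments are partial. If \<open>\<chi>\<close> is undefined at \<open>x\<close>, then the clause for
  \<open>Bind a x\<close> makes \<open>a\<close> undefined as well.\<close>

primrec sat ::
  "('a, 'r) signature \<Rightarrow> ('a, 'r, 'd) struct \<Rightarrow> ('a + 'v \<rightharpoonup> 'd) \<Rightarrow> ('a, 'r, 'v) fm \<Rightarrow> bool"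
where
  "sat \<Sigma> R \<chi> (Rel r) \<longleftrightarrow> (\<chi> \<circ> Inl) |` ar \<Sigma> r \<in> interp R r"
| "sat \<Sigma> R \<chi> (Neg \<phi>) \<longleftrightarrow> \<not> sat \<Sigma> R \<chi> \<phi>"
| "sat \<Sigma> R \<chi> (Conj \<phi> \<psi>) \<longleftrightarrow> sat \<Sigma> R \<chi> \<phi> \<and> sat \<Sigma> R \<chi> \<psi>"
| "sat \<Sigma> R \<chi> (Disj \<phi> \<psi>) \<longleftrightarrow> sat \<Sigma> R \<chi> \<phi> \<or> sat \<Sigma> R \<chi> \<psi>"
| "sat \<Sigma> R \<chi> (Ex x \<phi>) \<longleftrightarrow> (\<exists>d \<in> Dom R. sat \<Sigma> R (\<chi>(Inr x \<mapsto> d)) \<phi>)"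
| "sat \<Sigma> R \<chi> (All x \<phi>) \<longleftrightarrow> (\<forall>d \<in> Dom R. sat \<Sigma> R (\<chi>(Inr x \<mapsto> d)) \<phi>)"
| "sat \<Sigma> R \<chi> (Bind a x \<phi>) \<longleftrightarrow> sat \<Sigma> R (\<chi>(Inl a := \<chi> (Inr x))) \<phi>"

definition models :: "('a, 'r) signature \<Rightarrow> ('a, 'r, 'd) struct \<Rightarrow> ('a, 'r, 'v) fm \<Rightarrow> bool" where
  "models \<Sigma> R \<phi> \<longleftrightarrow> sat \<Sigma> R Map.empty \<phi>"

text \<open>HOL cannot quantify over all types of domain elements inside a formula, so the type
  from which domains are drawn is a parameter. Domains are arbitrary non-empty subsets of
  that type. Inequivalence over one type already gives two sentences with different models.\<close>

definition equivalent ::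
  "'d itself \<Rightarrow> ('a, 'r) signature \<Rightarrow> ('a, 'r, 'v) fm \<Rightarrow> ('a, 'r, 'v) fm \<Rightarrow> bool"
where
  "equivalent (_ :: 'd itself) \<Sigma> \<phi> \<psi> \<longleftrightarrow>
     (\<forall>R :: ('a, 'r, 'd) struct. is_structure \<Sigma> R \<longrightarrow> models \<Sigma> R \<phi> = models \<Sigma> R \<psi>)"

datatype quantifier = Exists | Forall

fun quantify :: "(quantifier \<times> 'v) list \<Rightarrow> ('a, 'r, 'v) fm \<Rightarrow> ('a, 'r, 'v) fm" where
  "quantify [] \<phi> = \<phi>"
| "quantify ((Exists, x) # p) \<phi> = Ex x (quantify p \<phi>)"
| "quantify ((Forall, x) # p) \<phi> = All x (quantify p \<phi>)"

fun bind :: "('a \<times> 'v) list \<Rightarrow> ('a, 'r, 'v) fm \<Rightarrow> ('a, 'r, 'v) fm" where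
  "bind [] \<phi> = \<phi>"
| "bind ((a, x) # b) \<phi> = Bind a x (bind b \<phi>)"

definition quantification_prefix :: "(quantifier \<times> 'v) list \<Rightarrow> bool" where
  "quantification_prefix p \<longleftrightarrow> distinct (map snd p)"

definition binding_prefix :: "('a, 'r) signature \<Rightarrow> ('a \<times> 'v) list \<Rightarrow> bool" where
  "binding_prefix \<Sigma> b \<longleftrightarrow> distinct (map fst b) \<and> fst ` set b \<subseteq> Args \<Sigma>"

text \<open>\<open>derived_relation \<Sigma> A \<phi>\<close>: all relations occurring in \<open>\<phi>\<close> have argument set \<open>A\<close>.\<close>

inductive derived_relation :: "('a, 'r) signature \<Rightarrow> 'a set \<Rightarrow> ('a, 'r, 'v) fm \<Rightarrow> bool"
  for \<Sigma> :: "('a, 'r) signature" and A :: "'a set"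
where
  Rel: "r \<in> Rels \<Sigma> \<Longrightarrow> ar \<Sigma> r = A \<Longrightarrow> derived_relation \<Sigma> A (Rel r)"
| Neg: "derived_relation \<Sigma> A \<phi> \<Longrightarrow> derived_relation \<Sigma> A (Neg \<phi>)"
| Conj: "derived_relation \<Sigma> A \<phi> \<Longrightarrow> derived_relation \<Sigma> A \<psi> \<Longrightarrow> derived_relation \<Sigma> A (Conj \<phi> \<psi>)"
| Disj: "derived_relation \<Sigma> A \<phi> \<Longrightarrow> derived_relation \<Sigma> A \<psi> \<Longrightarrow> derived_relation \<Sigma> A (Disj \<phi> \<psi>)"

inductive ob_matrix :: "('a, 'r) signature \<Rightarrow> ('a, 'r, 'v) fm \<Rightarrow> bool"
  for \<Sigma> :: "('a, 'r) signature"
where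
  bound: "binding_prefix \<Sigma> b \<Longrightarrow> derived_relation \<Sigma> A \<rho> \<Longrightarrow> ob_matrix \<Sigma> (bind b \<rho>)"

inductive cb_matrix :: "('a, 'r) signature \<Rightarrow> ('a, 'r, 'v) fm \<Rightarrow> bool"
  for \<Sigma> :: "('a, 'r) signature"
where
  bound: "binding_prefix \<Sigma> b \<Longrightarrow> derived_relation \<Sigma> A \<rho> \<Longrightarrow> cb_matrix \<Sigma> (bind b \<rho>)"
| Conj: "cb_matrix \<Sigma> \<phi> \<Longrightarrow> cb_matrix \<Sigma> \<psi> \<Longrightarrow> cb_matrix \<Sigma> (Conj \<phi> \<psi>)"

inductive db_matrix :: "('a, 'r) signature \<Rightarrow> ('a, 'r, 'v) fm \<Rightarrow> bool"
  for \<Sigma> :: "('a, 'r) signature"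
where
  bound: "binding_prefix \<Sigma> b \<Longrightarrow> derived_relation \<Sigma> A \<rho> \<Longrightarrow> db_matrix \<Sigma> (bind b \<rho>)"
| Disj: "db_matrix \<Sigma> \<phi> \<Longrightarrow> db_matrix \<Sigma> \<psi> \<Longrightarrow> db_matrix \<Sigma> (Disj \<phi> \<psi>)"

inductive positive_combination :: "(('a, 'r, 'v) fm \<Rightarrow> bool) \<Rightarrow> ('a, 'r, 'v) fm \<Rightarrow> bool"
  for M :: "('a, 'r, 'v) fm \<Rightarrow> bool"
where
  quantified: "quantification_prefix p \<Longrightarrow> M \<psi> \<Longrightarrow> positive_combination M (quantify p \<psi>)"
| Conj: "positive_combination M \<phi> \<Longrightarrow> positive_combination M \<psi> \<Longrightarrow> positive_combination M (Conj \<phi> \<psi>)"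
| Disj: "positive_combination M \<phi> \<Longrightarrow> positive_combination M \<psi> \<Longrightarrow> positive_combination M (Disj \<phi> \<psi>)"

definition OBFOL :: "('a, 'r) signature \<Rightarrow> ('a, 'r, 'v) fm \<Rightarrow> bool" where
  "OBFOL \<Sigma> = positive_combination (ob_matrix \<Sigma>)"

definition CBFOL :: "('a, 'r) signature \<Rightarrow> ('a, 'r, 'v) fm \<Rightarrow> bool" where
  "CBFOL \<Sigma> = positive_combination (cb_matrix \<Sigma>)"

definition DBFOL :: "('a, 'r) signature \<Rightarrow> ('a, 'r, 'v) fm \<Rightarrow> bool" where
  "DBFOL \<Sigma> = positive_combination (db_matrix \<Sigma>)"

end

(* An OBFOL sentence is a positive Boolean combination of sentences each of which mentions only
   relations with one fixed argument set. Hence it cannot tell apart two structures whose reducts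
   to each argument set are isomorphic, even if the isomorphisms differ. With unary relations
   0 and 1 whose argument sets are {0} and {1}, interpreted over the domain {0, 1} by equal
   singletons in one structure and by complementary singletons in the other, both
   "some x satisfies both relations" and "every x satisfies one of them" do tell them apart. *)

theory Submission
  imports Defs
begin

section \<open>Inclusion of OBFOL in the two larger fragments\<close>

text \<open>The outer grammar is shared by all three fragments and only the matrices
  \<open>M\<close> vary, so this reduces inclusions of fragments to inclusions of matrices.\<close>

lemma positive_combination_mono:
  assumes "positive_combination M \<phi>" and "\<And>\<psi>. M \<psi> \<Longrightarrow> N \<psi>"
  shows "positive_combination N \<phi>"
  using assms(1)
proof induction
  case (quantified p \<psi>)
  then show ?case using assms(2) by (intro positive_combination.quantified)
qed (rule positive_combination.Conj positive_combination.Disj; assumption)+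

lemma ob_matrix_imp_cb_matrix: "ob_matrix \<Sigma> \<phi> \<Longrightarrow> cb_matrix \<Sigma> \<phi>"
  by (induction rule: ob_matrix.induct) (rule cb_matrix.bound)

lemma ob_matrix_imp_db_matrix: "ob_matrix \<Sigma> \<phi> \<Longrightarrow> db_matrix \<Sigma> \<phi>"
  by (induction rule: ob_matrix.induct) (rule db_matrix.bound)

lemma OBFOL_imp_CBFOL: "OBFOL \<Sigma> \<phi> \<Longrightarrow> CBFOL \<Sigma> \<phi>"
  unfolding OBFOL_def CBFOL_def
  by (erule positive_combination_mono) (rule ob_matrix_imp_cb_matrix)

lemma OBFOL_imp_DBFOL: "OBFOL \<Sigma> \<phi> \<Longrightarrow> DBFOL \<Sigma> \<phi>"
  unfolding OBFOL_def DBFOL_def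
  by (erule positive_combination_mono) (rule ob_matrix_imp_db_matrix)

section \<open>Transfer of truth along maps of domains\<close>

lemma set2_fm_bind [simp]: "set2_fm (bind b \<phi>) = set2_fm \<phi>"
  by (induction b \<phi> rule: bind.induct) auto

lemma set2_fm_quantify [simp]: "set2_fm (quantify p \<phi>) = set2_fm \<phi>"
  by (induction p \<phi> rule: quantify.induct) auto

text \<open>Passes from the argument set to the set of relation symbols that occur, which is what
  the hypothesis of \<open>sat_map\<close> speaks about.\<close>

lemma derived_relation_rels:
  "derived_relation \<Sigma> A \<phi> \<Longrightarrow> set2_fm \<phi> \<subseteq> {r \<in> Rels \<Sigma>. ar \<Sigma> r = A}"
  by (induction rule: derived_relation.induct) auto

lemma map_option_comp_upd_Some: "(map_option f \<circ> m)(x \<mapsto> f d) = map_option f \<circ> m(x \<mapsto> d)"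
  by (rule ext) simp

text \<open>Injectivity of \<open>f\<close> is not required, because FOL as defined here has no equality.\<close>

lemma sat_map:
  assumes "f ` Dom R = Dom R'"
    and "\<And>r t. r \<in> set2_fm \<phi> \<Longrightarrow> t \<in> interp R r \<longleftrightarrow> map_option f \<circ> t \<in> interp R' r"
  shows "sat \<Sigma> R \<chi> \<phi> \<longleftrightarrow> sat \<Sigma> R' (map_option f \<circ> \<chi>) \<phi>"
  using assms(2)
proof (induction \<phi> arbitrary: \<chi>)
  case (Rel r)
  have "map_option f \<circ> (\<chi> \<circ> Inl) |` ar \<Sigma> r = ((map_option f \<circ> \<chi>) \<circ> Inl) |` ar \<Sigma> r"
    by (auto simp: restrict_map_def)
  moreover have "(\<chi> \<circ> Inl) |` ar \<Sigma> r \<in> interp R r \<longleftrightarrow>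
      map_option f \<circ> (\<chi> \<circ> Inl) |` ar \<Sigma> r \<in> interp R' r"
    by (rule Rel) simp
  ultimately show ?case by (simp only: sat.simps)
next
  case (Ex x \<phi>)
  then have "sat \<Sigma> R (\<chi>(Inr x \<mapsto> d)) \<phi> \<longleftrightarrow> sat \<Sigma> R' ((map_option f \<circ> \<chi>)(Inr x \<mapsto> f d)) \<phi>" for d
    unfolding map_option_comp_upd_Some by (auto simp only: fm.set)
  \<comment> \<open>Writing \<open>Dom R'\<close> as the image of \<open>Dom R\<close> gives every
    witness in it the form \<open>f d\<close>; this is where surjectivity enters.\<close>
  then show ?case by (simp only: sat.simps bex_simps ball_simps flip: assms(1))
next
  case (All x \<phi>)
  then have "sat \<Sigma> R (\<chi>(Inr x \<mapsto> d)) \<phi> \<longleftrightarrow> sat \<Sigma> R' ((map_option f \<circ> \<chi>)(Inr x \<mapsto> f d)) \<phi>" for d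
    unfolding map_option_comp_upd_Some by (auto simp only: fm.set)
  then show ?case by (simp only: sat.simps bex_simps ball_simps flip: assms(1))
next
  case (Bind a x \<phi>)
  have "(map_option f \<circ> \<chi>)(Inl a := (map_option f \<circ> \<chi>) (Inr x)) =
      map_option f \<circ> \<chi>(Inl a := \<chi> (Inr x))"
    by (rule ext) simp
  with Bind show ?case by (simp only: sat.simps fm.set)
qed auto

text \<open>Each block \<open>quantify p \<psi>\<close> uses relations of a single argument set and
  is evaluated under the empty assignment, so a map chosen for that set settles its truth value.
  Outside the blocks only truth values are combined, hence maps for different \<open>A\<close> need
  not agree.\<close>

lemma OBFOL_invariant:
  assumes "OBFOL \<Sigma> \<phi>"
    and iso: "\<And>A. \<exists>f. f ` Dom R = Dom R' \<and>
      (\<forall>r \<in> Rels \<Sigma>. ar \<Sigma> r = A \<longrightarrow> (\<forall>t. t \<in> interp R r \<longleftrightarrow> map_option f \<circ> t \<in> interp R' r))"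
  shows "models \<Sigma> R \<phi> \<longleftrightarrow> models \<Sigma> R' \<phi>"
  using assms(1) unfolding OBFOL_def
proof induction
  case (quantified p \<psi>)
  from \<open>ob_matrix \<Sigma> \<psi>\<close> obtain A where A: "set2_fm \<psi> \<subseteq> {r \<in> Rels \<Sigma>. ar \<Sigma> r = A}"
  proof cases
    case (bound b A \<rho>)
    then show ?thesis using that[of A] derived_relation_rels[of \<Sigma> A \<rho>] by simp
  qed
  obtain f where f: "f ` Dom R = Dom R'"
    "\<forall>r \<in> Rels \<Sigma>. ar \<Sigma> r = A \<longrightarrow> (\<forall>t. t \<in> interp R r \<longleftrightarrow> map_option f \<circ> t \<in> interp R' r)"
    using iso[of A] by blast
  \<comment> \<open>The empty assignment is unchanged by composition with
    \<open>map_option f\<close>, so the transfer begins and ends at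
    \<open>Map.empty\<close>.\<close>
  have "sat \<Sigma> R Map.empty (quantify p \<psi>) \<longleftrightarrow>
      sat \<Sigma> R' (map_option f \<circ> Map.empty) (quantify p \<psi>)"
  proof (rule sat_map[OF f(1)])
    fix r t
    assume "r \<in> set2_fm (quantify p \<psi>)"
    then have "r \<in> Rels \<Sigma>" "ar \<Sigma> r = A"
      using A by auto
    then show "t \<in> interp R r \<longleftrightarrow> map_option f \<circ> t \<in> interp R' r"
      using f(2) by blast
  qed
  then show ?case by (simp add: models_def comp_def)
next
  case (Conj \<phi> \<psi>)
  then show ?case by (simp only: models_def sat.simps)
next
  case (Disj \<phi> \<psi>)
  then show ?case by (simp only: models_def sat.simps)
qed

section \<open>Two structures and two separating sentences\<close>

text \<open>Each relation symbol doubles as its own argument name, so the two argument sets differ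
  and no derived relation can contain both symbols.\<close>

definition two_unary :: "(nat, nat) signature" where
  "two_unary = \<lparr>Args = {0, 1}, Rels = {0, 1}, ar = \<lambda>r. {r}\<rparr>"

definition overlapping :: "(nat, nat, nat) struct" where
  "overlapping = \<lparr>Dom = {0, 1}, interp = \<lambda>r. {[r \<mapsto> 0]}\<rparr>"

text \<open>Relation \<open>r\<close> holds of the element \<open>r\<close> only: names and elements coincide.\<close>

definition complementary :: "(nat, nat, nat) struct" where
  "complementary = \<lparr>Dom = {0, 1}, interp = \<lambda>r. {[r \<mapsto> r]}\<rparr>"

definition some_both :: "'v \<Rightarrow> (nat, nat, 'v) fm" where
  "some_both x = Ex x (Conj (Bind 0 x (Rel 0)) (Bind 1 x (Rel 1)))"

definition all_either :: "'v \<Rightarrow> (nat, nat, 'v) fm" where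
  "all_either x = All x (Disj (Bind 0 x (Rel 0)) (Bind 1 x (Rel 1)))"

lemma wf_two_unary: "wf_signature two_unary"
  by (simp add: wf_signature_def two_unary_def)

lemma is_structure_overlapping: "is_structure two_unary overlapping"
  by (simp add: is_structure_def two_unary_def overlapping_def)

lemma is_structure_complementary: "is_structure two_unary complementary"
  by (simp add: is_structure_def two_unary_def complementary_def)

lemma sentence_some_both: "sentence two_unary (some_both x)"
  by (simp add: sentence_def some_both_def two_unary_def)

lemma sentence_all_either: "sentence two_unary (all_either x)"
  by (simp add: sentence_def all_either_def two_unary_def)

lemma CBFOL_some_both: "CBFOL two_unary (some_both x)"
proof -
  have "cb_matrix two_unary (Bind r x (Rel r))" if "r \<in> {0, 1}" for r
    using that cb_matrix.bound[of two_unary "[(r, x)]" "{r}" "Rel r"]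
    by (simp add: binding_prefix_def two_unary_def derived_relation.Rel)
  then have "positive_combination (cb_matrix two_unary)
      (quantify [(Exists, x)] (Conj (Bind 0 x (Rel 0)) (Bind 1 x (Rel 1))))"
    by (intro positive_combination.quantified cb_matrix.Conj)
      (simp_all add: quantification_prefix_def)
  then show ?thesis by (simp add: CBFOL_def some_both_def)
qed

lemma DBFOL_all_either: "DBFOL two_unary (all_either x)"
proof -
  have "db_matrix two_unary (Bind r x (Rel r))" if "r \<in> {0, 1}" for r
    using that db_matrix.bound[of two_unary "[(r, x)]" "{r}" "Rel r"]
    by (simp add: binding_prefix_def two_unary_def derived_relation.Rel)
  then have "positive_combination (db_matrix two_unary)
      (quantify [(Forall, x)] (Disj (Bind 0 x (Rel 0)) (Bind 1 x (Rel 1))))"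
    by (intro positive_combination.quantified db_matrix.Disj)
      (simp_all add: quantification_prefix_def)
  then show ?thesis by (simp add: DBFOL_def all_either_def)
qed

text \<open>Turns the atoms of both sentences into equations between elements, after which their
  truth is a check over the domain {0, 1}.\<close>

lemma sat_Bind_Rel:
  assumes "interp R r = {[r \<mapsto> c]}"
  shows "sat two_unary R (\<chi>(Inr x \<mapsto> d)) (Bind r x (Rel r)) \<longleftrightarrow> d = c"
proof -
  have "((\<chi>(Inr x \<mapsto> d, Inl r \<mapsto> d)) \<circ> Inl) |` {r} = [r \<mapsto> d]"
    by (auto simp: restrict_map_def)
  then show ?thesis
    using assms by (simp add: two_unary_def) (auto dest: map_upd_eqD1)
qed

lemma models_some_both:
  "models two_unary overlapping (some_both x)"
  "\<not> models two_unary complementary (some_both x)"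
  \<comment> \<open>The clause \<open>sat.simps(7)\<close> for \<open>Bind\<close> is withheld so
    that \<open>sat_Bind_Rel\<close> meets the bound atoms intact.\<close>
  by (simp_all add: models_def some_both_def sat_Bind_Rel overlapping_def complementary_def
      del: sat.simps(7))

lemma models_all_either:
  "\<not> models two_unary overlapping (all_either x)"
  "models two_unary complementary (all_either x)"
  by (simp_all add: models_def all_either_def sat_Bind_Rel overlapping_def complementary_def
      del: sat.simps(7))

lemma OBFOL_overlapping_complementary:
  assumes "OBFOL two_unary \<psi>"
  shows "models two_unary overlapping \<psi> \<longleftrightarrow> models two_unary complementary \<psi>"
  using assms
proof (rule OBFOL_invariant)
  fix A :: "nat set"
  \<comment> \<open>Here \<open>t\<close> may take values outside the domain. Truncated subtraction
    sends every positive number to 0, so 0 is still the only preimage of 1.\<close>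
  have one: "t = [1 \<mapsto> 0] \<longleftrightarrow> map_option (\<lambda>d. 1 - d) \<circ> t = [1 \<mapsto> 1]" for t :: "nat \<rightharpoonup> nat"
  proof -
    have "Suc 0 - z = Suc 0 \<longleftrightarrow> z = 0" for z
      by auto
    then show ?thesis by (simp add: fun_eq_iff)
  qed
  show "\<exists>f. f ` Dom overlapping = Dom complementary \<and>
      (\<forall>r \<in> Rels two_unary. ar two_unary r = A \<longrightarrow>
        (\<forall>t. t \<in> interp overlapping r \<longleftrightarrow> map_option f \<circ> t \<in> interp complementary r))"
  proof (cases "A = {0}")
    case True
    \<comment> \<open>Relation 0 holds of exactly the element 0 in both structures, so the identity
      serves.\<close>
    then show ?thesis
      by (intro exI[of _ id]) (auto simp: two_unary_def overlapping_def complementary_def option.map_id0)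
  next
    \<comment> \<open>This also covers every \<open>A\<close> that is the argument set of no
      relation. At most relation 1 remains, and swapping 0 and 1 carries its singleton {0} to
      {1}.\<close>
    case False
    then have r: "r = 1" if "r \<in> Rels two_unary" "ar two_unary r = A" for r
      using that by (auto simp: two_unary_def)
    show ?thesis
    proof (intro exI[of _ "\<lambda>d. 1 - d"] conjI ballI impI allI)
      show "(\<lambda>d. 1 - d) ` Dom overlapping = Dom complementary"
        by (auto simp: overlapping_def complementary_def)
    next
      fix r and t :: "nat \<rightharpoonup> nat"
      assume "r \<in> Rels two_unary" "ar two_unary r = A"
      then have "r = 1" by (rule r)
      then show "t \<in> interp overlapping r \<longleftrightarrow> map_option (\<lambda>d. 1 - d) \<circ> t \<in> interp complementary r"
        unfolding overlapping_def complementary_def struct.simps singleton_iff by (simp only: one)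
    qed
  qed
qed

lemma not_equivalent_OBFOL:
  assumes "models two_unary overlapping \<phi> \<noteq> models two_unary complementary \<phi>"
    and "OBFOL two_unary \<psi>"
  shows "\<not> equivalent TYPE(nat) two_unary \<phi> \<psi>"
proof
  assume "equivalent TYPE(nat) two_unary \<phi> \<psi>"
  then have "models two_unary R \<phi> = models two_unary R \<psi>"
    if "is_structure two_unary R" for R :: "(nat, nat, nat) struct"
    using that by (simp add: equivalent_def)
  with assms show False
    by (simp add: OBFOL_overlapping_complementary is_structure_overlapping is_structure_complementary)
qed

theorem mainTheorem5:
  shows "(\<forall>(\<Sigma> :: ('a, 'r) signature) (\<phi> :: ('a, 'r, 'v) fm).
            wf_signature \<Sigma> \<and> sentence \<Sigma> \<phi> \<and> OBFOL \<Sigma> \<phi> \<longrightarrow> CBFOL \<Sigma> \<phi> \<and> DBFOL \<Sigma> \<phi>) \<and>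
         (\<exists>\<Sigma> :: (nat, nat) signature. wf_signature \<Sigma> \<and>
            (\<exists>\<phi> :: (nat, nat, 'v) fm. sentence \<Sigma> \<phi> \<and> CBFOL \<Sigma> \<phi> \<and>
               (\<forall>\<psi> :: (nat, nat, 'v) fm. sentence \<Sigma> \<psi> \<and> OBFOL \<Sigma> \<psi> \<longrightarrow>
                  \<not> equivalent TYPE(nat) \<Sigma> \<phi> \<psi>)) \<and>
            (\<exists>\<phi> :: (nat, nat, 'v) fm. sentence \<Sigma> \<phi> \<and> DBFOL \<Sigma> \<phi> \<and>
               (\<forall>\<psi> :: (nat, nat, 'v) fm. sentence \<Sigma> \<psi> \<and> OBFOL \<Sigma> \<psi> \<longrightarrow>
                  \<not> equivalent TYPE(nat) \<Sigma> \<phi> \<psi>)))"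
proof (intro conjI exI[of _ two_unary])
  \<comment> \<open>Any variable can be the bound one, and HOL types are inhabited.\<close>
  fix x :: 'v
  have "\<not> equivalent TYPE(nat) two_unary (some_both x) \<psi>" if "OBFOL two_unary \<psi>" for \<psi>
    by (rule not_equivalent_OBFOL) (simp_all add: models_some_both that)
  then show "\<exists>\<phi> :: (nat, nat, 'v) fm. sentence two_unary \<phi> \<and> CBFOL two_unary \<phi> \<and>
      (\<forall>\<psi> :: (nat, nat, 'v) fm. sentence two_unary \<psi> \<and> OBFOL two_unary \<psi> \<longrightarrow>
        \<not> equivalent TYPE(nat) two_unary \<phi> \<psi>)"
    by (intro exI[of _ "some_both x"]) (simp add: sentence_some_both CBFOL_some_both)
  have "\<not> equivalent TYPE(nat) two_unary (all_either x) \<psi>" if "OBFOL two_unary \<psi>" for \<psi>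
    by (rule not_equivalent_OBFOL) (simp_all add: models_all_either that)
  then show "\<exists>\<phi> :: (nat, nat, 'v) fm. sentence two_unary \<phi> \<and> DBFOL two_unary \<phi> \<and>
      (\<forall>\<psi> :: (nat, nat, 'v) fm. sentence two_unary \<psi> \<and> OBFOL two_unary \<psi> \<longrightarrow>
        \<not> equivalent TYPE(nat) two_unary \<phi> \<psi>)"
    by (intro exI[of _ "all_either x"]) (simp add: sentence_all_either DBFOL_all_either)
qed (simp_all add: OBFOL_imp_CBFOL OBFOL_imp_DBFOL wf_two_unary)

end
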